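(* Let $A\in\mathbb{R}^{m\times n}$ have the factorization $$A=P\begin{pmatrix} I & \\ E & I\end{pmatrix}\begin{pmatrix} A_{11} & A_{12}\\ & S\end{pmatrix},\qquad S=A_{22}-EA_{12},\quad E=A_{21}A_{11}^{-1},$$ with $A_{11}=A_{\mathcal{I},\mathcal{J}}$ and $k=|\mathcal{J}|$ (notation as in the context). Let $\widehat{\mathcal{J}}$ be obtained from a uniform random sampling of $\{1:n\}\setminus\mathcal{J}$ with $|\widehat{\mathcal{J}}|=b$, and let $\mathcal{L}$ be given by $(\{1:n\}\setminus\mathcal{J})\circ\mathcal{L}=\widehat{\mathcal{J}}$. Let $\mathcal{E}=A-UA_{\mathcal{I},:}$, where $U=P\begin{pmatrix} I\\ E\end{pmatrix}$. Assume that there are $c\geq 1$ and $f\geq1$ such that $\Vert E\Vert_{\max}\leq c$ and, for $1\leq i\leq k$, $1\leq j\leq\min\{m,n\}-k$, $$\sigma_{i}(A_{11})\geq\frac{\sigma_{i}(A)}{f},\quad\sigma_{j}(S)\leq\sigma_{k+j}(A)f,\quad\Vert A_{11}^{-1}A_{12}\Vert_{\max}\leq c.$$ Then $H=\frac{n-k}{b}S_{:,\mathcal{L}}S_{:,\mathcal{L}}^{T}$ satisfies $$\frac{\Vert\mathcal{E}\Vert_{2}}{\Vert A\Vert_{2}}\leq\frac{\sqrt{\Vert\operatorname{E}(H)\Vert_{2}}}{\Vert A_{11}\Vert_{2}}\leq f^{2}\frac{\sigma_{k+1}(A)}{\Vert A\Vert_{2}}.$$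
   Context: $\sigma_i(\cdot)$ denotes the $i$-th largest singular value; $\Vert\cdot\Vert_{\max}$ is the largest entrywise magnitude; $\Vert\cdot\Vert_2$ is the spectral norm; $\operatorname{E}(\cdot)$ is the (entrywise) expectation with respect to the random choice of $\widehat{\mathcal{J}}$; $1:n$ stands for $1,\ldots,n$. In the paper $c$ and $f$ are values of low-degree polynomials in $m,n,k$. Setting: $A$ is fixed, $\mathcal{I}\subset\{1:m\}$ and $\mathcal{J}\subset\{1:n\}$ are fixed with $|\mathcal{I}|=|\mathcal{J}|=k$, $A_{11}=A_{\mathcal{I},\mathcal{J}}$ (submatrix with rows $\mathcal{I}$, columns $\mathcal{J}$) is nonsingular, and $A_{\mathcal{I},:}$ is the submatrix of the rows $\mathcal{I}$. The columns of $A$ are assumed permuted so that those of $\mathcal{J}$ come first, and $P$ is a permutation matrix with $P^TA=\begin{pmatrix} A_{11} & A_{12}\\ A_{21} & A_{22}\end{pmatrix}$, where the first block row is formed by the rows $\mathcal{I}$. The notation $(\{1:n\}\setminus\mathcal{J})\circ\mathcal{L}$ is the subset of $\{1:n\}\setminus\mathcal{J}$ consisting of its entries at the positions listed in $\mathcal{L}$; thus $S_{:,\mathcal{L}}$ consists of the $b$ columns of the $(m-k)\times(n-k)$ matrix $S$ corresponding to the columns $\widehat{\mathcal{J}}$ of $A$. *)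

theory Defs
  imports
    "HOL-Probability.Probability_Mass_Function"
    "Jordan_Normal_Form.Matrix"
    "Jordan_Normal_Form.Char_Poly"
    "Jordan_Normal_Form.DL_Submatrix"
begin

text \<open>Rows, columns and index sets are numbered from 0, so \<open>1:n\<close> becomes \<open>{0..<n}\<close>;
  singular values keep their usual numbering from 1.\<close>

definition vec_norm2 :: "real vec \<Rightarrow> real" where
  "vec_norm2 v = sqrt (v \<bullet> v)"

definition spectral_norm :: "real mat \<Rightarrow> real" where
  "spectral_norm A = Sup {vec_norm2 (A *\<^sub>v x) | x. x \<in> carrier_vec (dim_col A) \<and> vec_norm2 x \<le> 1}"

text \<open>The inserted 0 only matters for matrices without entries.\<close>

definition max_norm :: "real mat \<Rightarrow> real" where
  "max_norm A = Max (insert 0 {\<bar>A $$ (i, j)\<bar> | i j. i < dim_row A \<and> j < dim_col A})"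

text \<open>Square roots of the eigenvalues of \<open>A\<^sup>T A\<close>, repeated according to multiplicity, in
  decreasing order. There are \<open>dim_col A\<close> of them; those beyond position
  \<open>min (dim_row A) (dim_col A)\<close> are 0.\<close>

definition singular_values :: "real mat \<Rightarrow> real list" where
  "singular_values A =
    rev (sorted_list_of_multiset (image_mset sqrt (proots (char_poly (transpose_mat A * A)))))"

definition singular_value :: "nat \<Rightarrow> real mat \<Rightarrow> real" where
  "singular_value i A =
    (if 1 \<le> i \<and> i \<le> length (singular_values A) then singular_values A ! (i - 1) else 0)"

definition permutation_matrix :: "nat \<Rightarrow> real mat \<Rightarrow> bool" where
  "permutation_matrix m P \<longleftrightarrow>
    (\<exists>p. p permutes {0..<m} \<and> P = mat m m (\<lambda>(i, j). if i = p j then 1 else 0))"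

definition append_cols :: "real mat \<Rightarrow> real mat \<Rightarrow> real mat" where
  "append_cols A B = four_block_mat A B (0\<^sub>m 0 (dim_col A)) (0\<^sub>m 0 (dim_col B))"

text \<open>\<open>A\<close> with its columns permuted so that those of \<open>J\<close> come first; the order within \<open>J\<close> and
  within its complement is kept.\<close>

definition columns_first :: "nat set \<Rightarrow> real mat \<Rightarrow> real mat" where
  "columns_first J A =
    append_cols (submatrix A UNIV J) (submatrix A UNIV ({0..<dim_col A} - J))"

lemma columns_first_initial:
  assumes "k \<le> dim_col A"
  shows "columns_first {0..<k} A = A"
proof -
  let ?n = "dim_col A"
  have c1: "card {j. j < ?n \<and> j < k} = k"
  proof -
    have "{j. j < ?n \<and> j < k} = {0..<k}" using assms by auto
    then show ?thesis by simp
  qed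
  have p1: "pick {0..<k} j = j" if "j < k" for j
  proof -
    have "{a \<in> {0..<k}. a < j} = {0..<j}" using that by auto
    then show ?thesis using pick_card_in_set[of j "{0..<k}"] that by simp
  qed
  have p2: "pick {k..<?n} (j - k) = j" if "k \<le> j" "j < ?n" for j
  proof -
    have "{a \<in> {k..<?n}. a < j} = {k..<j}" using that by auto
    then show ?thesis using pick_card_in_set[of j "{k..<?n}"] that by simp
  qed
  have c2: "{0..<?n} - {0..<k} = {k..<?n}" by auto
  have c3: "card {j. j < ?n \<and> k \<le> j \<and> j < ?n} = ?n - k"
  proof -
    have "{j. j < ?n \<and> k \<le> j \<and> j < ?n} = {k..<?n}" by auto
    then show ?thesis by simp
  qed
  show ?thesis
    unfolding columns_first_def append_cols_def submatrix_def c2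
    by (rule eq_matI) (use assms in \<open>auto simp: pick_UNIV c1 c3 p1 p2\<close>)
qed

text \<open>The subset \<open>T \<circ> L\<close> of \<open>T\<close> consisting of its entries at the positions listed in \<open>L\<close>.\<close>

definition entries_at :: "nat set \<Rightarrow> nat set \<Rightarrow> nat set" where
  "entries_at T L = pick T ` L"

text \<open>Uniform sampling of \<open>b\<close> elements of \<open>T\<close> without replacement.\<close>

definition samples :: "nat set \<Rightarrow> nat \<Rightarrow> nat set set" where
  "samples T b = {Jh. Jh \<subseteq> T \<and> card Jh = b}"

definition uniform_sampling :: "nat set \<Rightarrow> nat \<Rightarrow> nat set pmf" where
  "uniform_sampling T b = pmf_of_set (samples T b)"

definition expectation_mat :: "nat \<Rightarrow> nat \<Rightarrow> 'a pmf \<Rightarrow> ('a \<Rightarrow> real mat) \<Rightarrow> real mat" where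
  "expectation_mat r s p H = mat r s (\<lambda>(i, j). measure_pmf.expectation p (\<lambda>\<omega>. H \<omega> $$ (i, j)))"

end

theory Submission
  imports Defs
begin

text \<open>Each column of \<open>S\<close> is sampled with probability \<open>b / (n - k)\<close>, so the factor
  \<open>(n - k) / b\<close> makes \<open>H\<close> an unbiased estimate of the whole Gram matrix: \<open>E(H) = S S\<^sup>T\<close>
  (\<open>expectation_sampled_gram\<close>). Since \<open>\<parallel>S S\<^sup>T\<parallel> = \<parallel>S\<parallel>\<^sup>2\<close> (\<open>spectral_norm_gram\<close>), the middle
  quantity is \<open>\<parallel>S\<parallel> / \<parallel>A\<^sub>1\<^sub>1\<parallel>\<close>.

  For the first inequality, subtracting \<open>U A\<^sub>I\<close> from \<open>A\<close> leaves, up to permutations of rows and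
  columns, just the block \<open>S\<close>, so the residual has norm at most \<open>\<parallel>S\<parallel>\<close>
  (\<open>residual_spectral_norm_le\<close>), while \<open>\<parallel>A\<^sub>1\<^sub>1\<parallel> \<le> \<parallel>A\<parallel>\<close> because \<open>A\<^sub>1\<^sub>1\<close> is a submatrix
  (\<open>spectral_norm_submatrix_le\<close>).

  The second inequality rests on the first instance of each singular value estimate,
  \<open>\<sigma>\<^sub>1(S) \<le> f \<sigma>\<^sub>k\<^sub>+\<^sub>1(A)\<close> and \<open>\<sigma>\<^sub>1(A) \<le> f \<sigma>\<^sub>1(A\<^sub>1\<^sub>1)\<close>. To read these as estimates of norms one
  needs that the largest singular value, defined through the roots of a characteristic polynomial,
  is the spectral norm, defined as a supremum (\<open>singular_value_1\<close>). The point there is that the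
  supremum squared is an eigenvalue of \<open>M\<^sup>T M\<close>; this is shown by a quantitative argument with the
  adjugate instead of by compactness of the sphere (\<open>spectral_norm_squared_eigenvalue\<close>).\<close>

unbundle no inner_syntax


section \<open>Euclidean norm\<close>

lemma scalar_prod_self_eq_sum: "v \<bullet> v = (\<Sum>i<dim_vec v. (v $ i)\<^sup>2)" for v :: "real vec"
  by (simp add: scalar_prod_def power2_eq_square atLeast0LessThan)

lemma vec_norm2_squared: "(vec_norm2 v)\<^sup>2 = v \<bullet> v"
  unfolding vec_norm2_def by (simp add: scalar_prod_self_eq_sum sum_nonneg)

lemma vec_norm2_nonneg [simp]: "0 \<le> vec_norm2 v"
  unfolding vec_norm2_def by (simp add: scalar_prod_self_eq_sum sum_nonneg)

lemma vec_norm2_le_iff: "vec_norm2 v \<le> vec_norm2 w \<longleftrightarrow> v \<bullet> v \<le> w \<bullet> w"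
  unfolding vec_norm2_def by simp

lemma vec_norm2_smult: "vec_norm2 (a \<cdot>\<^sub>v v) = \<bar>a\<bar> * vec_norm2 v"
proof -
  have "(a \<cdot>\<^sub>v v) \<bullet> (a \<cdot>\<^sub>v v) = a\<^sup>2 * (v \<bullet> v)"
    by (simp add: scalar_prod_self_eq_sum sum_distrib_left power_mult_distrib)
  then show ?thesis unfolding vec_norm2_def by (simp add: real_sqrt_mult)
qed

lemma vec_norm2_eq_0D:
  assumes "vec_norm2 v = 0" "v \<in> carrier_vec n"
  shows "v = 0\<^sub>v n"
proof -
  have "(\<Sum>i<dim_vec v. (v $ i)\<^sup>2) = 0"
    using assms(1) vec_norm2_squared[of v] by (simp add: scalar_prod_self_eq_sum)
  then show ?thesis using assms(2) by (subst (asm) sum_nonneg_eq_0_iff) (auto intro!: eq_vecI)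
qed

lemma vec_norm2_zero [simp]: "vec_norm2 (0\<^sub>v n) = 0"
  by (simp add: vec_norm2_def scalar_prod_self_eq_sum)

lemma exists_unit_vector:
  assumes "1 \<le> n"
  obtains x where "x \<in> carrier_vec n" "vec_norm2 x = 1"
proof
  show "unit_vec n 0 \<in> carrier_vec n" by simp
  show "vec_norm2 (unit_vec n 0) = 1"
    using assms by (simp add: vec_norm2_def)
qed

lemma abs_scalar_prod_le:
  assumes "u \<in> carrier_vec n" "v \<in> carrier_vec n"
  shows "\<bar>u \<bullet> v\<bar> \<le> vec_norm2 u * vec_norm2 v"
proof -
  have "(u \<bullet> v)\<^sup>2 \<le> (u \<bullet> u) * (v \<bullet> v)"
    using Cauchy_Schwarz_ineq_sum[of "\<lambda>i. u $ i" "\<lambda>i. v $ i" "{..<n}"] assms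
    by (simp add: scalar_prod_self_eq_sum scalar_prod_def atLeast0LessThan)
  then have "(u \<bullet> v)\<^sup>2 \<le> (vec_norm2 u * vec_norm2 v)\<^sup>2"
    by (simp add: power_mult_distrib vec_norm2_squared)
  then show ?thesis
    by (simp add: abs_le_square_iff abs_mult flip: abs_le_square_iff)
qed

section \<open>The spectral norm as an operator norm\<close>

text \<open>The supremum defining the spectral norm is only informative once the set is known to be
  bounded; the Frobenius norm \<open>sqrt ?F\<close> is a bound, by Cauchy-Schwarz on each row.\<close>

lemma mult_mat_vec_bounded:
  "\<exists>C. \<forall>x \<in> carrier_vec (dim_col A). vec_norm2 (A *\<^sub>v x) \<le> C * vec_norm2 x"
proof (intro exI ballI)
  fix x :: "real vec" assume x: "x \<in> carrier_vec (dim_col A)"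
  let ?F = "\<Sum>i<dim_row A. row A i \<bullet> row A i"
  have "(row A i \<bullet> x)\<^sup>2 \<le> (row A i \<bullet> row A i) * (x \<bullet> x)" for i
  proof -
    have "\<bar>row A i \<bullet> x\<bar> \<le> \<bar>vec_norm2 (row A i) * vec_norm2 x\<bar>"
      using abs_scalar_prod_le[of "row A i" "dim_col A" x] x by simp
    then show ?thesis
      unfolding abs_le_square_iff by (simp add: power_mult_distrib vec_norm2_squared)
  qed
  then have "(A *\<^sub>v x) \<bullet> (A *\<^sub>v x) \<le> ?F * (x \<bullet> x)"
    by (simp add: scalar_prod_self_eq_sum[of "A *\<^sub>v x"] sum_distrib_right sum_mono)
  then show "vec_norm2 (A *\<^sub>v x) \<le> sqrt ?F * vec_norm2 x"
    unfolding vec_norm2_def by (simp flip: real_sqrt_mult)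
qed

lemma bdd_above_spectral_norm_set:
  "bdd_above {vec_norm2 (A *\<^sub>v x) | x. x \<in> carrier_vec (dim_col A) \<and> vec_norm2 x \<le> 1}"
proof -
  obtain C where C: "vec_norm2 (A *\<^sub>v x) \<le> C * vec_norm2 x" if "x \<in> carrier_vec (dim_col A)" for x
    using mult_mat_vec_bounded by blast
  have "vec_norm2 (A *\<^sub>v x) \<le> \<bar>C\<bar>" if "x \<in> carrier_vec (dim_col A)" "vec_norm2 x \<le> 1" for x
  proof -
    have "C * vec_norm2 x \<le> \<bar>C\<bar> * 1" by (intro mult_mono) (use that in auto)
    then show ?thesis using C[OF that(1)] by simp
  qed
  then show ?thesis by (auto intro!: bdd_aboveI)
qed

lemma spectral_norm_nonneg [simp]: "0 \<le> spectral_norm A"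
proof -
  have "vec_norm2 (A *\<^sub>v 0\<^sub>v (dim_col A)) \<le> spectral_norm A"
    unfolding spectral_norm_def
    by (rule cSup_upper[OF _ bdd_above_spectral_norm_set]) (auto intro!: exI[of _ "0\<^sub>v (dim_col A)"])
  then show ?thesis using vec_norm2_nonneg order_trans by blast
qed

lemma mult_mat_vec_le_spectral_norm:
  assumes x: "x \<in> carrier_vec (dim_col A)"
  shows "vec_norm2 (A *\<^sub>v x) \<le> spectral_norm A * vec_norm2 x"
proof (cases "vec_norm2 x = 0")
  case True
  then have "x = 0\<^sub>v (dim_col A)" using vec_norm2_eq_0D x by blast
  moreover have "A *\<^sub>v 0\<^sub>v (dim_col A) = 0\<^sub>v (dim_row A)" by (auto intro!: eq_vecI)
  ultimately show ?thesis by simp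
next
  case False
  then have pos: "0 < vec_norm2 x" using vec_norm2_nonneg[of x] by linarith
  let ?y = "inverse (vec_norm2 x) \<cdot>\<^sub>v x"
  have "vec_norm2 ?y \<le> 1" "?y \<in> carrier_vec (dim_col A)"
    using pos x by (auto simp: vec_norm2_smult)
  then have "vec_norm2 (A *\<^sub>v ?y) \<le> spectral_norm A"
    unfolding spectral_norm_def by (intro cSup_upper[OF _ bdd_above_spectral_norm_set]) blast
  moreover have "vec_norm2 (A *\<^sub>v ?y) = vec_norm2 (A *\<^sub>v x) / vec_norm2 x"
    using pos mult_mat_vec[OF carrier_matI[OF refl refl] x]
    by (simp add: vec_norm2_smult divide_inverse)
  ultimately show ?thesis using pos by (simp add: pos_divide_le_eq)
qed

lemma spectral_norm_leI:
  assumes "0 \<le> C"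
    and "\<And>x. x \<in> carrier_vec (dim_col A) \<Longrightarrow> vec_norm2 (A *\<^sub>v x) \<le> C * vec_norm2 x"
  shows "spectral_norm A \<le> C"
  unfolding spectral_norm_def
proof (rule cSup_least)
  show "{vec_norm2 (A *\<^sub>v x) |x. x \<in> carrier_vec (dim_col A) \<and> vec_norm2 x \<le> 1} \<noteq> {}"
    by (auto intro!: exI[of _ "0\<^sub>v (dim_col A)"])
  fix r assume "r \<in> {vec_norm2 (A *\<^sub>v x) |x. x \<in> carrier_vec (dim_col A) \<and> vec_norm2 x \<le> 1}"
  then obtain x where x: "r = vec_norm2 (A *\<^sub>v x)" "x \<in> carrier_vec (dim_col A)" "vec_norm2 x \<le> 1"
    by blast
  have "C * vec_norm2 x \<le> C * 1" using x(3) assms(1) by (rule mult_left_mono)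
  then show "r \<le> C" using assms(2)[OF x(2)] x(1) by simp
qed

lemma spectral_norm_mult_le:
  assumes A: "A \<in> carrier_mat l m" and B: "B \<in> carrier_mat m n"
  shows "spectral_norm (A * B) \<le> spectral_norm A * spectral_norm B"
proof (rule spectral_norm_leI)
  fix x :: "real vec" assume "x \<in> carrier_vec (dim_col (A * B))"
  then have x: "x \<in> carrier_vec n" using B by simp
  have "vec_norm2 (A *\<^sub>v (B *\<^sub>v x)) \<le> spectral_norm A * vec_norm2 (B *\<^sub>v x)"
    by (rule mult_mat_vec_le_spectral_norm) (use A B x in auto)
  also have "\<dots> \<le> spectral_norm A * (spectral_norm B * vec_norm2 x)"
    by (intro mult_left_mono mult_mat_vec_le_spectral_norm) (use B x in auto)
  finally show "vec_norm2 (A * B *\<^sub>v x) \<le> spectral_norm A * spectral_norm B * vec_norm2 x"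
    by (simp add: assoc_mult_mat_vec[OF A B x] mult.assoc)
qed simp

text \<open>Submultiplicativity would make \<open>B * A\<close> the zero map if \<open>A\<close> had norm 0. The dimension must
  be positive because the empty matrix is invertible with norm 0.\<close>

lemma spectral_norm_pos_of_left_inverse:
  assumes A: "A \<in> carrier_mat n n" and B: "B \<in> carrier_mat n n" "B * A = 1\<^sub>m n" and n: "1 \<le> n"
  shows "0 < spectral_norm A"
proof (rule ccontr)
  assume "\<not> 0 < spectral_norm A"
  then have zero: "spectral_norm A = 0" using spectral_norm_nonneg[of A] by linarith
  obtain x where x: "x \<in> carrier_vec n" "vec_norm2 x = 1" using exists_unit_vector[OF n] .
  have "vec_norm2 ((B * A) *\<^sub>v x) \<le> spectral_norm (B * A) * vec_norm2 x"
    by (rule mult_mat_vec_le_spectral_norm) (use A x in simp)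
  also have "spectral_norm (B * A) \<le> 0"
    using spectral_norm_mult_le[OF B(1) A] zero by simp
  finally show False using x by (simp add: B(2))
qed

lemma self_scalar_mult_mat_vec:
  fixes A :: "real mat"
  assumes A: "A \<in> carrier_mat m n" and x: "x \<in> carrier_vec n"
  shows "(A *\<^sub>v x) \<bullet> (A *\<^sub>v x) = x \<bullet> ((transpose_mat A * A) *\<^sub>v x)"
proof -
  have "x \<bullet> ((transpose_mat A * A) *\<^sub>v x) = x \<bullet> (transpose_mat A *\<^sub>v (A *\<^sub>v x))"
    by (subst assoc_mult_mat_vec[of _ n m _ n]) (use A x in auto)
  also have "\<dots> = (transpose_mat A *\<^sub>v (A *\<^sub>v x)) \<bullet> x"
    by (rule comm_scalar_prod[of _ n]) (use A x in auto)
  also have "\<dots> = (A *\<^sub>v x) \<bullet> (A *\<^sub>v x)"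
    by (rule transpose_vec_mult_scalar[OF A x]) (use A x in auto)
  finally show ?thesis ..
qed

text \<open>From \<open>|A x|\<^sup>2 = x \<bullet> (A\<^sup>T A x)\<close> and Cauchy-Schwarz.\<close>

lemma spectral_norm_squared_le_gram:
  "(spectral_norm A)\<^sup>2 \<le> spectral_norm (transpose_mat A * A)"
proof -
  let ?G = "transpose_mat A * A" and ?n = "dim_col A"
  have "spectral_norm A \<le> sqrt (spectral_norm ?G)"
  proof (rule spectral_norm_leI)
    fix x :: "real vec" assume x: "x \<in> carrier_vec ?n"
    have "(A *\<^sub>v x) \<bullet> (A *\<^sub>v x) = x \<bullet> (?G *\<^sub>v x)"
      by (rule self_scalar_mult_mat_vec[of _ "dim_row A" ?n]) (use x in auto)
    also have "\<dots> \<le> vec_norm2 x * vec_norm2 (?G *\<^sub>v x)"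
      by (rule order_trans[OF abs_ge_self abs_scalar_prod_le[of _ ?n]])
        (use x in \<open>auto intro: carrier_vecI\<close>)
    also have "\<dots> \<le> vec_norm2 x * (spectral_norm ?G * vec_norm2 x)"
      by (intro mult_left_mono mult_mat_vec_le_spectral_norm) (use x in auto)
    also have "\<dots> = spectral_norm ?G * (x \<bullet> x)"
      by (simp add: power2_eq_square flip: vec_norm2_squared)
    finally show "vec_norm2 (A *\<^sub>v x) \<le> sqrt (spectral_norm ?G) * vec_norm2 x"
      unfolding vec_norm2_def by (simp flip: real_sqrt_mult)
  qed simp
  then have "(spectral_norm A)\<^sup>2 \<le> (sqrt (spectral_norm ?G))\<^sup>2"
    by (intro power_mono) auto
  then show ?thesis by simp
qed

text \<open>Submultiplicativity turns \<open>\<parallel>B\<parallel>\<^sup>2 \<le> \<parallel>B\<^sup>T B\<parallel>\<close> into \<open>\<parallel>B\<parallel> \<le> \<parallel>B\<^sup>T\<parallel>\<close>, and transposing twice gives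
  the converse.\<close>

lemma spectral_norm_transpose: "spectral_norm (transpose_mat A) = spectral_norm A"
proof -
  have le: "spectral_norm B \<le> spectral_norm (transpose_mat B)" for B
  proof -
    have "(spectral_norm B)\<^sup>2 \<le> spectral_norm (transpose_mat B) * spectral_norm B"
      using spectral_norm_squared_le_gram[of B]
        spectral_norm_mult_le[of "transpose_mat B" "dim_col B" "dim_row B" B "dim_col B"]
      by fastforce
    then show ?thesis
      using spectral_norm_nonneg[of B] spectral_norm_nonneg[of "transpose_mat B"]
      by (cases "spectral_norm B = 0") (auto simp: power2_eq_square)
  qed
  show ?thesis using le[of A] le[of "transpose_mat A"] by simp
qed

lemma spectral_norm_gram: "spectral_norm (A * transpose_mat A) = (spectral_norm A)\<^sup>2"
proof (rule antisym)
  show "spectral_norm (A * transpose_mat A) \<le> (spectral_norm A)\<^sup>2"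
    using spectral_norm_mult_le[of A "dim_row A" "dim_col A" "transpose_mat A" "dim_row A"]
    by (simp add: spectral_norm_transpose power2_eq_square)
  show "(spectral_norm A)\<^sup>2 \<le> spectral_norm (A * transpose_mat A)"
    using spectral_norm_squared_le_gram[of "transpose_mat A"] by (simp add: spectral_norm_transpose)
qed

section \<open>The largest singular value\<close>

text \<open>On an eigenvector \<open>v\<close>, \<open>|M v|\<^sup>2 = e |v|\<^sup>2\<close>.\<close>

lemma gram_eigenvalue_bounds:
  assumes M: "M \<in> carrier_mat m n" and "eigenvalue (transpose_mat M * M) e"
  shows "0 \<le> e" "e \<le> (spectral_norm M)\<^sup>2"
proof -
  let ?G = "transpose_mat M * M"
  obtain v where v: "v \<in> carrier_vec n" "v \<noteq> 0\<^sub>v n" and ev: "?G *\<^sub>v v = e \<cdot>\<^sub>v v"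
    using assms unfolding eigenvalue_def eigenvector_def by auto
  have eq: "(M *\<^sub>v v) \<bullet> (M *\<^sub>v v) = e * (v \<bullet> v)"
    using self_scalar_mult_mat_vec[OF M v(1)] v(1) by (simp add: ev)
  have pos: "0 < v \<bullet> v"
    using vec_norm2_eq_0D[OF _ v(1)] v(2) vec_norm2_squared[of v] by (metis zero_less_power2)
  show "0 \<le> e"
    using eq pos vec_norm2_squared[of "M *\<^sub>v v"] by (metis zero_le_mult_iff zero_le_power2 not_less)
  have "(vec_norm2 (M *\<^sub>v v))\<^sup>2 \<le> (spectral_norm M * vec_norm2 v)\<^sup>2"
    by (intro power_mono mult_mat_vec_le_spectral_norm) (use M v in auto)
  then show "e \<le> (spectral_norm M)\<^sup>2"
    using pos by (simp add: eq vec_norm2_squared power_mult_distrib)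
qed

text \<open>The adjugate plays the part of the inverse: \<open>det B \<cdot> x = adj B (B x)\<close>.\<close>

lemma nonsingular_bounded_below:
  assumes B: "B \<in> carrier_mat n n" and det: "det B \<noteq> (0 :: real)"
  obtains d where "0 < d" "\<And>x. x \<in> carrier_vec n \<Longrightarrow> d * (x \<bullet> x) \<le> (B *\<^sub>v x) \<bullet> (B *\<^sub>v x)"
proof
  let ?a = "spectral_norm (adj_mat B) + 1"
  let ?d = "(det B)\<^sup>2 / ?a\<^sup>2"
  have a: "0 < ?a" using spectral_norm_nonneg[of "adj_mat B"] by linarith
  show "0 < ?d" using det a by simp
  fix x :: "real vec" assume x: "x \<in> carrier_vec n"
  have "(adj_mat B * B) *\<^sub>v x = det B \<cdot>\<^sub>v x"
    unfolding adj_mat(3)[OF B] using x by (auto intro!: eq_vecI)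
  then have "det B \<cdot>\<^sub>v x = adj_mat B *\<^sub>v (B *\<^sub>v x)"
    using assoc_mult_mat_vec[OF adj_mat(1)[OF B] B x] by simp
  then have "\<bar>det B\<bar> * vec_norm2 x = vec_norm2 (adj_mat B *\<^sub>v (B *\<^sub>v x))"
    by (simp flip: vec_norm2_smult)
  also have "\<dots> \<le> spectral_norm (adj_mat B) * vec_norm2 (B *\<^sub>v x)"
    by (rule mult_mat_vec_le_spectral_norm) (use adj_mat(1)[OF B] B x in auto)
  also have "\<dots> \<le> ?a * vec_norm2 (B *\<^sub>v x)" by (intro mult_right_mono) auto
  finally have "(\<bar>det B\<bar> * vec_norm2 x)\<^sup>2 \<le> (?a * vec_norm2 (B *\<^sub>v x))\<^sup>2"
    by (intro power_mono) auto
  then have "(det B)\<^sup>2 * (x \<bullet> x) \<le> ?a\<^sup>2 * ((B *\<^sub>v x) \<bullet> (B *\<^sub>v x))"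
    by (simp add: power_mult_distrib vec_norm2_squared)
  then show "?d * (x \<bullet> x) \<le> (B *\<^sub>v x) \<bullet> (B *\<^sub>v x)"
    using a by (simp add: pos_divide_le_eq mult.commute)
qed

text \<open>For a positive semidefinite \<open>B\<close>, a small value of the quadratic form forces a small image.
  The quadratic form is evaluated at \<open>x - B x / \<beta>\<close>, one gradient step from \<open>x\<close>, where it would
  become negative if \<open>|B x|\<^sup>2\<close> exceeded \<open>\<beta> (x \<bullet> B x)\<close>.\<close>

lemma symmetric_psd_image_le:
  fixes B :: "real mat"
  assumes B: "B \<in> carrier_mat n n" and sym: "transpose_mat B = B"
    and psd: "\<And>x. x \<in> carrier_vec n \<Longrightarrow> 0 \<le> x \<bullet> (B *\<^sub>v x)"
    and \<beta>: "spectral_norm B \<le> \<beta>" "0 < \<beta>" and x: "x \<in> carrier_vec n"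
  shows "(B *\<^sub>v x) \<bullet> (B *\<^sub>v x) \<le> \<beta> * (x \<bullet> (B *\<^sub>v x))"
proof -
  define y where "y = B *\<^sub>v x"
  define z where "z = B *\<^sub>v y"
  have y: "y \<in> carrier_vec n" and z: "z \<in> carrier_vec n" using B x by (auto simp: y_def z_def)
  have xz: "x \<bullet> z = y \<bullet> y"
    using transpose_vec_mult_scalar[OF B y x] comm_scalar_prod[OF x z] sym
    by (simp add: y_def[symmetric] z_def[symmetric])
  have yz: "y \<bullet> z \<le> \<beta> * (y \<bullet> y)"
  proof -
    have "y \<bullet> z \<le> vec_norm2 y * vec_norm2 z"
      using abs_scalar_prod_le[OF y z] by linarith
    also have "\<dots> \<le> vec_norm2 y * (\<beta> * vec_norm2 y)"
    proof (rule mult_left_mono)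
      have "vec_norm2 z \<le> spectral_norm B * vec_norm2 y"
        unfolding z_def by (rule mult_mat_vec_le_spectral_norm) (use B y in auto)
      also have "\<dots> \<le> \<beta> * vec_norm2 y" by (intro mult_right_mono \<beta>) simp
      finally show "vec_norm2 z \<le> \<beta> * vec_norm2 y" .
    qed simp
    finally show ?thesis by (simp add: power2_eq_square mult_ac flip: vec_norm2_squared)
  qed
  define c where "c = 1 / \<beta>"
  let ?w = "x - c \<cdot>\<^sub>v y"
  have "B *\<^sub>v ?w = y - c \<cdot>\<^sub>v z"
    using mult_minus_distrib_mat_vec[OF B x, of "c \<cdot>\<^sub>v y"] mult_mat_vec[OF B y, of c] y
    by (simp add: y_def z_def)
  moreover have "?w \<bullet> (y - c \<cdot>\<^sub>v z) = (x \<bullet> y - c * (x \<bullet> z)) - c * (y \<bullet> y - c * (y \<bullet> z))"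
    using x y z
    by (simp add: minus_scalar_prod_distrib[of _ n] scalar_prod_minus_distrib[of _ n]
        right_diff_distrib)
  ultimately have "?w \<bullet> (B *\<^sub>v ?w) = x \<bullet> y - 2 * (y \<bullet> y) / \<beta> + (y \<bullet> z) / \<beta>\<^sup>2"
    by (simp add: xz c_def power2_eq_square right_diff_distrib diff_divide_distrib)
  moreover have "0 \<le> ?w \<bullet> (B *\<^sub>v ?w)" by (rule psd) (use x y in auto)
  ultimately have "0 \<le> x \<bullet> y - 2 * (y \<bullet> y) / \<beta> + (y \<bullet> z) / \<beta>\<^sup>2" by simp
  also have "(y \<bullet> z) / \<beta>\<^sup>2 \<le> (y \<bullet> y) / \<beta>"
    using yz \<beta>(2) by (simp add: power2_eq_square field_simps)
  finally have "(y \<bullet> y) / \<beta> \<le> x \<bullet> y" by simp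
  then show ?thesis using \<beta>(2) by (simp add: y_def[symmetric] pos_divide_le_eq mult.commute)
qed

text \<open>The usual proof takes a maximizer of \<open>|M x|\<close> on the unit sphere, which needs compactness.
  Here the norm is only used as a supremum: if \<open>\<mu> = \<parallel>M\<parallel>\<^sup>2\<close> were not an eigenvalue, the positive
  semidefinite matrix \<open>B = \<mu> I - M\<^sup>T M\<close> would be nonsingular, hence bounded below, so its quadratic
  form \<open>\<mu> |x|\<^sup>2 - |M x|\<^sup>2\<close> would be at least a fixed positive multiple of \<open>|x|\<^sup>2\<close>. That gives
  a smaller bound \<open>\<nu>\<close> for \<open>|M x|\<^sup>2 / |x|\<^sup>2\<close>, contrary to the choice of \<open>\<mu>\<close>.\<close>

lemma spectral_norm_squared_eigenvalue:
  assumes M: "M \<in> carrier_mat m n" and n: "1 \<le> n"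
  shows "eigenvalue (transpose_mat M * M) ((spectral_norm M)\<^sup>2)"
proof (rule ccontr)
  let ?G = "transpose_mat M * M"
  define \<mu> where "\<mu> = (spectral_norm M)\<^sup>2"
  define B where "B = \<mu> \<cdot>\<^sub>m 1\<^sub>m n - ?G"
  have G: "?G \<in> carrier_mat n n" and B: "B \<in> carrier_mat n n" using M by (auto simp: B_def)
  assume "\<not> eigenvalue ?G ((spectral_norm M)\<^sup>2)"
  then have "det (char_matrix ?G \<mu>) \<noteq> 0" using eigenvalue_det[OF G] by (simp add: \<mu>_def)
  moreover have "char_matrix ?G \<mu> = - B"
    unfolding char_matrix_def B_def using M by (auto intro!: eq_matI)
  ultimately have "det B \<noteq> 0" using det_0_negate[OF B] by simp
  then obtain d where d: "0 < d" "\<And>x. x \<in> carrier_vec n \<Longrightarrow> d * (x \<bullet> x) \<le> (B *\<^sub>v x) \<bullet> (B *\<^sub>v x)"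
    using nonsingular_bounded_below[OF B] by blast
  have sym: "transpose_mat B = B"
    unfolding B_def using M
    by (auto intro!: eq_matI comm_scalar_prod[of _ m])
  have form: "x \<bullet> (B *\<^sub>v x) = \<mu> * (x \<bullet> x) - (M *\<^sub>v x) \<bullet> (M *\<^sub>v x)" if x: "x \<in> carrier_vec n" for x
  proof -
    have "B *\<^sub>v x = \<mu> \<cdot>\<^sub>v x - ?G *\<^sub>v x"
      unfolding B_def using x M
      by (subst minus_mult_distrib_mat_vec[of _ n n]) (auto intro!: eq_vecI)
    then have "x \<bullet> (B *\<^sub>v x) = \<mu> * (x \<bullet> x) - x \<bullet> (?G *\<^sub>v x)"
      using x G by (simp add: scalar_prod_minus_distrib[of _ n] del: assoc_mult_mat_vec)
    then show ?thesis using self_scalar_mult_mat_vec[OF M x] by simp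
  qed
  have psd: "0 \<le> x \<bullet> (B *\<^sub>v x)" if x: "x \<in> carrier_vec n" for x
  proof -
    have "(vec_norm2 (M *\<^sub>v x))\<^sup>2 \<le> (spectral_norm M * vec_norm2 x)\<^sup>2"
      by (intro power_mono mult_mat_vec_le_spectral_norm) (use M x in auto)
    then show ?thesis by (simp add: form[OF x] \<mu>_def vec_norm2_squared power_mult_distrib)
  qed
  define \<beta> where "\<beta> = spectral_norm B + 1"
  have \<beta>: "spectral_norm B \<le> \<beta>" "0 < \<beta>"
    using spectral_norm_nonneg[of B] unfolding \<beta>_def by linarith+
  define \<nu> where "\<nu> = \<mu> - d / \<beta>"
  have gap: "(M *\<^sub>v x) \<bullet> (M *\<^sub>v x) \<le> \<nu> * (x \<bullet> x)" if x: "x \<in> carrier_vec n" for x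
  proof -
    have "d * (x \<bullet> x) \<le> \<beta> * (\<mu> * (x \<bullet> x) - (M *\<^sub>v x) \<bullet> (M *\<^sub>v x))"
      using d(2)[OF x] symmetric_psd_image_le[OF B sym psd \<beta> x] form[OF x] by simp
    then show ?thesis using \<beta>(2) by (simp add: \<nu>_def field_simps)
  qed
  (* A unit vector witnesses that the improved bound is nonnegative, so that its square root
     is a legitimate norm bound. *)
  obtain u where u: "u \<in> carrier_vec n" "vec_norm2 u = 1" using exists_unit_vector[OF n] .
  have "0 \<le> \<nu>"
    using gap[OF u(1)] vec_norm2_squared[of u] vec_norm2_squared[of "M *\<^sub>v u"] u(2)
    by (metis mult.right_neutral one_power2 order_trans zero_le_power2)
  have "spectral_norm M \<le> sqrt \<nu>"
  proof (rule spectral_norm_leI)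
    fix x :: "real vec" assume "x \<in> carrier_vec (dim_col M)"
    then have "(M *\<^sub>v x) \<bullet> (M *\<^sub>v x) \<le> \<nu> * (x \<bullet> x)" using gap M by simp
    then show "vec_norm2 (M *\<^sub>v x) \<le> sqrt \<nu> * vec_norm2 x"
      unfolding vec_norm2_def by (simp flip: real_sqrt_mult)
  qed (simp add: \<open>0 \<le> \<nu>\<close>)
  then have "\<mu> \<le> \<nu>"
    unfolding \<mu>_def using \<open>0 \<le> \<nu>\<close> power_mono[of "spectral_norm M" "sqrt \<nu>" 2] by simp
  moreover have "0 < d / \<beta>" using d(1) \<beta>(2) by simp
  ultimately show False by (simp add: \<nu>_def)
qed

lemma set_singular_values:
  "set (singular_values M) = sqrt ` {e. eigenvalue (transpose_mat M * M) e}"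
proof -
  let ?G = "transpose_mat M * M"
  have G: "?G \<in> carrier_mat (dim_col M) (dim_col M)" by (intro carrier_matI) simp_all
  have "char_poly ?G \<noteq> 0" using degree_monic_char_poly[OF G] by (metis coeff_0 zero_neq_one)
  then have roots: "set_mset (proots (char_poly ?G)) = {e. eigenvalue ?G e}"
    by (simp add: eigenvalue_root_char_poly[OF G])
  show ?thesis unfolding singular_values_def by (simp add: roots)
qed

lemma singular_value_nonneg: "0 \<le> singular_value i M"
proof (cases "1 \<le> i \<and> i \<le> length (singular_values M)")
  case True
  then have "i - 1 < length (singular_values M)" by linarith
  then have "singular_value i M \<in> set (singular_values M)"
    using True by (simp add: singular_value_def)
  then obtain e where "singular_value i M = sqrt e" "eigenvalue (transpose_mat M * M) e"
    unfolding set_singular_values by blast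
  then show ?thesis using gram_eigenvalue_bounds(1)[of M "dim_row M" "dim_col M" e] by simp
qed (auto simp: singular_value_def)

text \<open>The squared norm is an eigenvalue of the Gram matrix and no eigenvalue is larger.\<close>

theorem singular_value_1:
  assumes "1 \<le> dim_col M"
  shows "singular_value 1 M = spectral_norm M"
proof -
  let ?s = "singular_values M"
  have "eigenvalue (transpose_mat M * M) ((spectral_norm M)\<^sup>2)"
    by (rule spectral_norm_squared_eigenvalue[of M "dim_row M" "dim_col M"]) (use assms in auto)
  then have "sqrt ((spectral_norm M)\<^sup>2) \<in> set ?s" unfolding set_singular_values by (rule imageI[OF CollectI])
  then have mem: "spectral_norm M \<in> set ?s" by simp
  then have ne: "?s \<noteq> []" by auto
  have upper: "s \<le> spectral_norm M" if s: "s \<in> set ?s" for s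
  proof -
    obtain e where e: "s = sqrt e" "eigenvalue (transpose_mat M * M) e"
      using s unfolding set_singular_values by blast
    then have "e \<le> (spectral_norm M)\<^sup>2"
      using gram_eigenvalue_bounds(2)[of M "dim_row M" "dim_col M" e] by simp
    then show ?thesis using e(1) real_sqrt_le_mono[of e "(spectral_norm M)\<^sup>2"] by simp
  qed
  have "sorted (rev ?s)" by (simp add: singular_values_def)
  then have "spectral_norm M \<le> hd ?s"
    using mem by (cases ?s) (auto simp: sorted_append)
  then have "hd ?s = spectral_norm M"
    using upper[OF hd_in_set[OF ne]] by (rule antisym[rotated])
  then show ?thesis using ne by (simp add: singular_value_def hd_conv_nth Suc_le_eq)
qed

section \<open>Selecting rows and columns\<close>

lemma bij_betw_pick:
  assumes "finite J"
  shows "bij_betw (pick J) {..<card J} J"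
proof -
  have inj: "inj_on (pick J) {..<card J}"
  proof (rule inj_onI)
    fix i j assume ij: "i \<in> {..<card J}" "j \<in> {..<card J}" "pick J i = pick J j"
    then show "i = j"
      using pick_mono_le[of i J j] pick_mono_le[of j J i] by (metis lessThan_iff nat_neq_iff)
  qed
  moreover have "pick J ` {..<card J} \<subseteq> J" using pick_in_set_le by auto
  ultimately have "pick J ` {..<card J} = J"
    using assms by (intro card_subset_eq) (auto simp: card_image)
  then show ?thesis using inj by (simp add: bij_betw_def)
qed

lemma sum_pick:
  assumes "finite J"
  shows "(\<Sum>i<card J. g (pick J i)) = sum g J"
  by (rule sum.reindex_bij_betw[OF bij_betw_pick[OF assms]])

lemma card_restrict_below:
  assumes "I \<subseteq> {0..<m}"
  shows "card {i. i < m \<and> i \<in> I} = card I"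
  using assms by (intro arg_cong[of _ _ card]) auto

lemma submatrix_carrier:
  assumes "A \<in> carrier_mat m n" "I \<subseteq> {0..<m}" "J \<subseteq> {0..<n}"
  shows "submatrix A I J \<in> carrier_mat (card I) (card J)"
  using assms by (auto simp: dim_submatrix card_restrict_below intro!: carrier_matI)

lemma submatrix_entry:
  assumes "A \<in> carrier_mat m n" "I \<subseteq> {0..<m}" "J \<subseteq> {0..<n}" "i < card I" "j < card J"
  shows "submatrix A I J $$ (i, j) = A $$ (pick I i, pick J j)"
  using assms by (intro submatrix_index) (auto simp: card_restrict_below)

lemma pick_initial:
  assumes "i < m"
  shows "pick {0..<m} i = i"
proof -
  have "{a \<in> {0..<m}. a < i} = {0..<i}" using assms by auto
  then show ?thesis using pick_card_in_set[of i "{0..<m}"] assms by simp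
qed

lemma submatrix_UNIV_rows:
  assumes "A \<in> carrier_mat m n"
  shows "submatrix A UNIV J = submatrix A {0..<m} J"
  unfolding submatrix_def using assms by (intro eq_matI) (auto simp: pick_UNIV pick_initial)

lemma submatrix_UNIV_cols:
  assumes "A \<in> carrier_mat m n"
  shows "submatrix A I UNIV = submatrix A I {0..<n}"
  unfolding submatrix_def using assms by (intro eq_matI) (auto simp: pick_UNIV pick_initial)

lemma submatrix_full:
  assumes "A \<in> carrier_mat m n"
  shows "submatrix A {0..<m} {0..<n} = A"
  unfolding submatrix_def using assms by (intro eq_matI) (auto simp: pick_initial)

lemma transpose_submatrix: "transpose_mat (submatrix A I J) = submatrix (transpose_mat A) J I"
  unfolding submatrix_def by (intro eq_matI) (simp_all add: pick_le)

text \<open>Selecting rows drops entries of the image \<open>A x\<close>.\<close>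

lemma spectral_norm_row_selection_le:
  assumes A: "A \<in> carrier_mat m n" and I: "I \<subseteq> {0..<m}"
  shows "spectral_norm (submatrix A I UNIV) \<le> spectral_norm A"
proof (rule spectral_norm_leI)
  let ?B = "submatrix A I UNIV"
  have B: "?B \<in> carrier_mat (card I) n"
    using submatrix_carrier[OF A I, of "{0..<n}"] by (simp add: submatrix_UNIV_cols[OF A])
  fix x :: "real vec" assume "x \<in> carrier_vec (dim_col ?B)"
  then have x: "x \<in> carrier_vec n" using B by simp
  have fin: "finite I" using I finite_subset by blast
  have entry: "(?B *\<^sub>v x) $ i = (A *\<^sub>v x) $ pick I i" if "i < card I" for i
  proof -
    have "pick I i < m" using pick_in_set_le[OF that] I by auto
    moreover have "row ?B i = row A (pick I i)"
      using that A B calculation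
      by (intro eq_vecI) (auto simp: submatrix_UNIV_cols[OF A] submatrix_entry[OF A I] pick_initial)
    ultimately show ?thesis using that A B by simp
  qed
  have "(?B *\<^sub>v x) \<bullet> (?B *\<^sub>v x) = (\<Sum>i<card I. ((A *\<^sub>v x) $ pick I i)\<^sup>2)"
    using B by (simp add: scalar_prod_self_eq_sum entry del: index_mult_mat_vec)
  also have "\<dots> = (\<Sum>i\<in>I. ((A *\<^sub>v x) $ i)\<^sup>2)" by (rule sum_pick[OF fin])
  also have "\<dots> \<le> (\<Sum>i<m. ((A *\<^sub>v x) $ i)\<^sup>2)" using I by (intro sum_mono2) auto
  also have "\<dots> = (A *\<^sub>v x) \<bullet> (A *\<^sub>v x)" using A by (simp add: scalar_prod_self_eq_sum)
  finally have "vec_norm2 (?B *\<^sub>v x) \<le> vec_norm2 (A *\<^sub>v x)" by (simp add: vec_norm2_le_iff)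
  also have "\<dots> \<le> spectral_norm A * vec_norm2 x"
    by (rule mult_mat_vec_le_spectral_norm) (use A x in simp)
  finally show "vec_norm2 (?B *\<^sub>v x) \<le> spectral_norm A * vec_norm2 x" .
qed simp

text \<open>Column selection is row selection of the transpose.\<close>

lemma spectral_norm_submatrix_le:
  assumes A: "A \<in> carrier_mat m n" and I: "I \<subseteq> {0..<m}" and J: "J \<subseteq> {0..<n}"
  shows "spectral_norm (submatrix A I J) \<le> spectral_norm A"
proof -
  have AJ: "submatrix A UNIV J \<in> carrier_mat m (card J)"
    using submatrix_carrier[OF A _ J, of "{0..<m}"] by (simp add: submatrix_UNIV_rows[OF A])
  have "spectral_norm (submatrix A I J) \<le> spectral_norm (submatrix A UNIV J)"
    by (subst submatrix_split) (rule spectral_norm_row_selection_le[OF AJ I])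
  also have "\<dots> = spectral_norm (submatrix (transpose_mat A) J UNIV)"
    by (simp add: spectral_norm_transpose flip: transpose_submatrix)
  also have "\<dots> \<le> spectral_norm A"
    using spectral_norm_row_selection_le[of "transpose_mat A" n m J] A J
    by (simp add: spectral_norm_transpose)
  finally show ?thesis .
qed

definition subvec :: "real vec \<Rightarrow> nat set \<Rightarrow> real vec" where
  "subvec x J = vec (card J) (\<lambda>i. x $ pick J i)"

lemma subvec_carrier [simp]: "subvec x J \<in> carrier_vec (card J)"
  by (simp add: subvec_def)

lemma vec_norm2_subvec_le:
  assumes "J \<subseteq> {0..<n}" "x \<in> carrier_vec n"
  shows "vec_norm2 (subvec x J) \<le> vec_norm2 x"
proof -
  have "subvec x J \<bullet> subvec x J = (\<Sum>i<card J. (x $ pick J i)\<^sup>2)"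
    by (simp add: subvec_def scalar_prod_self_eq_sum)
  also have "\<dots> = (\<Sum>i\<in>J. (x $ i)\<^sup>2)"
    by (rule sum_pick) (use assms finite_subset in blast)
  also have "\<dots> \<le> (\<Sum>i<n. (x $ i)\<^sup>2)" using assms by (intro sum_mono2) auto
  finally show ?thesis using assms by (simp add: vec_norm2_le_iff scalar_prod_self_eq_sum)
qed

lemma submatrix_mult_subvec:
  assumes A: "A \<in> carrier_mat m n" and I: "I \<subseteq> {0..<m}" and J: "J \<subseteq> {0..<n}" and i: "i < card I"
  shows "(submatrix A I J *\<^sub>v subvec x J) $ i = (\<Sum>j\<in>J. A $$ (pick I i, j) * x $ j)"
proof -
  have "(submatrix A I J *\<^sub>v subvec x J) $ i = (\<Sum>j<card J. A $$ (pick I i, pick J j) * x $ pick J j)"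
    using submatrix_carrier[OF A I J] i
    by (simp add: scalar_prod_def subvec_def atLeast0LessThan submatrix_entry[OF A I J])
  also have "\<dots> = (\<Sum>j\<in>J. A $$ (pick I i, j) * x $ j)"
    by (rule sum_pick) (use J finite_subset in blast)
  finally show ?thesis .
qed

lemma subvec_full:
  assumes "x \<in> carrier_vec n"
  shows "subvec x {0..<n} = x"
  using assms by (intro eq_vecI) (auto simp: subvec_def pick_initial)

lemma submatrix_split_cols:
  assumes A: "A \<in> carrier_mat m n" and I: "I \<subseteq> {0..<m}" and J: "J \<subseteq> {0..<n}"
    and x: "x \<in> carrier_vec n"
  shows "submatrix A I UNIV *\<^sub>v x
    = submatrix A I J *\<^sub>v subvec x J + submatrix A I ({0..<n} - J) *\<^sub>v subvec x ({0..<n} - J)"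
    (is "_ = ?B *\<^sub>v ?y + ?C *\<^sub>v ?z")
proof -
  have sub: "{0..<n} - J \<subseteq> {0..<n}" by blast
  have dims: "submatrix A I {0..<n} \<in> carrier_mat (card I) n" "?C \<in> carrier_mat (card I) (card ({0..<n} - J))"
    using submatrix_carrier[OF A I subset_refl] submatrix_carrier[OF A I sub] by simp_all
  have "submatrix A I {0..<n} *\<^sub>v subvec x {0..<n} = ?B *\<^sub>v ?y + ?C *\<^sub>v ?z"
  proof (rule eq_vecI)
    fix i assume "i < dim_vec (?B *\<^sub>v ?y + ?C *\<^sub>v ?z)"
    then have i: "i < card I" using dims by simp
    have "(\<Sum>j\<in>{0..<n}. A $$ (pick I i, j) * x $ j) = (\<Sum>j\<in>{0..<n} - J. A $$ (pick I i, j) * x $ j)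
        + (\<Sum>j\<in>J. A $$ (pick I i, j) * x $ j)"
      by (rule sum.subset_diff[OF J]) simp
    then show "(submatrix A I {0..<n} *\<^sub>v subvec x {0..<n}) $ i = (?B *\<^sub>v ?y + ?C *\<^sub>v ?z) $ i"
      using i dims submatrix_mult_subvec[OF A I J i] submatrix_mult_subvec[OF A I sub i]
        submatrix_mult_subvec[OF A I subset_refl i] by (simp del: index_mult_mat_vec)
  qed (use dims in simp)
  then show ?thesis using x by (simp add: subvec_full submatrix_UNIV_cols[OF A])
qed

lemma columns_first_mult_vec:
  assumes A: "A \<in> carrier_mat m n" and J: "J \<subseteq> {0..<n}" and x: "x \<in> carrier_vec n"
  shows "columns_first J A *\<^sub>v (subvec x J @\<^sub>v subvec x ({0..<n} - J)) = A *\<^sub>v x"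
    (is "_ *\<^sub>v (?y @\<^sub>v ?z) = _")
proof -
  let ?B = "submatrix A UNIV J" and ?C = "submatrix A UNIV ({0..<n} - J)"
  have sub: "{0..<n} - J \<subseteq> {0..<n}" by blast
  have B: "?B \<in> carrier_mat m (card J)" and C: "?C \<in> carrier_mat m (card ({0..<n} - J))"
    using submatrix_carrier[OF A subset_refl J] submatrix_carrier[OF A subset_refl sub]
    by (simp_all add: submatrix_UNIV_rows[OF A])
  have "columns_first J A
      = four_block_mat ?B ?C (0\<^sub>m 0 (card J)) (0\<^sub>m 0 (card ({0..<n} - J)))"
    using A B C by (simp add: columns_first_def append_cols_def)
  then have "columns_first J A *\<^sub>v (?y @\<^sub>v ?z) = (?B *\<^sub>v ?y + ?C *\<^sub>v ?z)
      @\<^sub>v (0\<^sub>m 0 (card J) *\<^sub>v ?y + 0\<^sub>m 0 (card ({0..<n} - J)) *\<^sub>v ?z)"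
    using four_block_mat_mult_vec[OF B C zero_carrier_mat zero_carrier_mat] by simp
  also have "\<dots> = ?B *\<^sub>v ?y + ?C *\<^sub>v ?z" by (intro eq_vecI) auto
  also have "\<dots> = A *\<^sub>v x"
    using submatrix_split_cols[OF A subset_refl J x] A
    by (simp add: submatrix_UNIV_rows[OF A] submatrix_UNIV_cols[OF A] submatrix_full[OF A])
  finally show ?thesis .
qed

section \<open>Sampling\<close>

lemma card_samples_containing:
  assumes T: "finite T" "t \<in> T" and b: "1 \<le> b"
  shows "card {K \<in> samples T b. t \<in> K} = (card T - 1) choose (b - 1)"
proof -
  have "bij_betw (insert t) {K. K \<subseteq> T - {t} \<and> card K = b - 1} {K \<in> samples T b. t \<in> K}"
  proof (rule bij_betwI[where g = "\<lambda>K. K - {t}"])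
    show "insert t \<in> {K. K \<subseteq> T - {t} \<and> card K = b - 1} \<rightarrow> {K \<in> samples T b. t \<in> K}"
    proof
      fix K assume "K \<in> {K. K \<subseteq> T - {t} \<and> card K = b - 1}"
      moreover from this have "finite K" using T finite_subset by blast
      ultimately have "card (insert t K) = b" using b by (subst card_insert_disjoint) auto
      then show "insert t K \<in> {K \<in> samples T b. t \<in> K}"
        using \<open>K \<in> _\<close> T by (auto simp: samples_def)
    qed
    show "(\<lambda>K. K - {t}) \<in> {K \<in> samples T b. t \<in> K} \<rightarrow> {K. K \<subseteq> T - {t} \<and> card K = b - 1}"
      using T finite_subset by (auto simp: samples_def)
  qed auto
  from bij_betw_same_card[OF this] show ?thesis
    using n_subsets[of "T - {t}" "b - 1"] T by simp
qed

text \<open>Each \<open>t\<close> lies in a random sample with probability \<open>b / |T|\<close>, by double counting with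
  \<open>N (N-1 choose b-1) = b (N choose b)\<close>.\<close>

lemma expectation_sum_uniform_sampling:
  fixes g :: "nat \<Rightarrow> real"
  assumes T: "finite T" and b: "1 \<le> b" "b \<le> card T"
    and h: "\<And>K. K \<in> samples T b \<Longrightarrow> h K = sum g K"
  shows "measure_pmf.expectation (uniform_sampling T b) h = real b / real (card T) * sum g T"
proof -
  let ?N = "card T"
  have card: "card (samples T b) = ?N choose b" unfolding samples_def by (rule n_subsets[OF T])
  then have pos: "0 < card (samples T b)" using b by simp
  have fin: "finite (samples T b)" "samples T b \<noteq> {}" using pos by (auto simp: card_gt_0_iff)
  have "sum h (samples T b) = (\<Sum>K\<in>samples T b. \<Sum>t\<in>T. if t \<in> K then g t else 0)"
  proof (rule sum.cong[OF refl])
    fix K assume K: "K \<in> samples T b"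
    then have "K \<subseteq> T" by (simp add: samples_def)
    then show "h K = (\<Sum>t\<in>T. if t \<in> K then g t else 0)"
      using h[OF K] T by (simp add: sum.If_cases Int_absorb1)
  qed
  also have "\<dots> = (\<Sum>t\<in>T. \<Sum>K\<in>samples T b. if t \<in> K then g t else 0)" by (rule sum.swap)
  also have "\<dots> = (\<Sum>t\<in>T. real ((?N - 1) choose (b - 1)) * g t)"
    using fin(1) card_samples_containing[OF T _ b(1)]
    by (intro sum.cong) (auto simp: sum.If_cases Int_def)
  finally have sum: "sum h (samples T b) = real ((?N - 1) choose (b - 1)) * sum g T"
    by (simp add: sum_distrib_left)
  have "?N * ((?N - 1) choose (b - 1)) = b * (?N choose b)"
    using binomial_absorption[of "b - 1" ?N] b by simp
  then have "real ?N * real ((?N - 1) choose (b - 1)) = real b * real (card (samples T b))"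
    by (simp add: card flip: of_nat_mult)
  moreover have "0 < real ?N" using b by simp
  ultimately have "real ((?N - 1) choose (b - 1)) / real (card (samples T b)) = real b / real ?N"
    using pos by (simp add: field_simps)
  moreover have "measure_pmf.expectation (uniform_sampling T b) h
      = real ((?N - 1) choose (b - 1)) / real (card (samples T b)) * sum g T"
    unfolding uniform_sampling_def using fin sum by (simp add: integral_pmf_of_set)
  ultimately show ?thesis by (simp only:)
qed

lemma gram_of_column_selection:
  assumes S: "S \<in> carrier_mat r N" and L: "L \<subseteq> {0..<N}" and ij: "i < r" "j < r"
  shows "(submatrix S UNIV L * transpose_mat (submatrix S UNIV L)) $$ (i, j)
    = (\<Sum>l\<in>L. S $$ (i, l) * S $$ (j, l))"
proof -
  have C: "submatrix S UNIV L \<in> carrier_mat r (card L)"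
    using submatrix_carrier[OF S subset_refl L] by (simp add: submatrix_UNIV_rows[OF S])
  have entry: "submatrix S UNIV L $$ (i, l) = S $$ (i, pick L l)" if "i < r" "l < card L" for i l
    using submatrix_entry[OF S subset_refl L, of i l] that
    by (simp add: submatrix_UNIV_rows[OF S] pick_initial)
  have "(submatrix S UNIV L * transpose_mat (submatrix S UNIV L)) $$ (i, j)
      = (\<Sum>l<card L. S $$ (i, pick L l) * S $$ (j, pick L l))"
    using C ij by (simp add: scalar_prod_def entry flip: lessThan_atLeast0)
  also have "\<dots> = (\<Sum>l\<in>L. S $$ (i, l) * S $$ (j, l))"
    by (rule sum_pick) (use L finite_subset in blast)
  finally show ?thesis .
qed

text \<open>\<open>S\<^sub>L S\<^sub>L\<^sup>T\<close> is the sum over \<open>l \<in> L\<close> of the rank-one matrices formed from column \<open>l\<close>, so by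
  linearity its expectation is \<open>b / N\<close> times the full sum \<open>S S\<^sup>T\<close>; the scaling factor cancels
  \<open>b / N\<close>.\<close>

lemma expectation_sampled_gram:
  assumes S: "S \<in> carrier_mat r N" and T: "finite T" "card T = N" and b: "1 \<le> b" "b \<le> N"
    and L: "\<And>K. K \<in> samples T b \<Longrightarrow> L K \<subseteq> {0..<N} \<and> entries_at T (L K) = K"
    and H: "\<And>K. H K = (real N / real b) \<cdot>\<^sub>m
      (submatrix S UNIV (L K) * transpose_mat (submatrix S UNIV (L K)))"
  shows "expectation_mat r r (uniform_sampling T b) H = S * transpose_mat S"
proof (rule eq_matI)
  fix i j assume "i < dim_row (S * transpose_mat S)" "j < dim_col (S * transpose_mat S)"
  then have ij: "i < r" "j < r" using S by simp_all
  (* The sampled set consists of column numbers of the large matrix; pos translates them back to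
     column positions in S. *)
  define pos where "pos = the_inv_into {..<N} (pick T)"
  define g where "g t = real N / real b * (S $$ (i, pos t) * S $$ (j, pos t))" for t
  have bij: "bij_betw (pick T) {..<N} T" using bij_betw_pick[OF T(1)] T(2) by simp
  have pos: "pos (pick T l) = l" if "l < N" for l
    using that bij unfolding pos_def bij_betw_def by (intro the_inv_into_f_f) auto
  have "H K $$ (i, j) = sum g K" if K: "K \<in> samples T b" for K
  proof -
    have LK: "L K \<subseteq> {0..<N}" "pick T ` L K = K" using L[OF K] by (auto simp: entries_at_def)
    have inj: "inj_on (pick T) (L K)"
      by (rule inj_on_subset[OF bij_betw_imp_inj_on[OF bij]]) (use LK(1) in auto)
    have C: "dim_row (submatrix S UNIV (L K)) = r" using S by (simp add: dim_submatrix)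
    have "H K $$ (i, j) = real N / real b * (\<Sum>l\<in>L K. S $$ (i, l) * S $$ (j, l))"
      unfolding H using gram_of_column_selection[OF S LK(1) ij] C ij
      by (simp del: index_mult_mat(1))
    also have "\<dots> = (\<Sum>l\<in>L K. g (pick T l))"
      unfolding g_def sum_distrib_left using LK(1) by (intro sum.cong) (auto simp: pos)
    also have "\<dots> = sum g (pick T ` L K)" using sum.reindex[OF inj, of g] by simp
    finally show ?thesis by (simp add: LK(2))
  qed
  then have "measure_pmf.expectation (uniform_sampling T b) (\<lambda>K. H K $$ (i, j))
      = real b / real N * sum g T"
    using expectation_sum_uniform_sampling[OF T(1) b(1), of "\<lambda>K. H K $$ (i, j)" g] b T(2) by simp
  also have "sum g T = (\<Sum>l<N. g (pick T l))" using sum_pick[OF T(1), of g] T(2) by simp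
  also have "\<dots> = real N / real b * (\<Sum>l<N. S $$ (i, l) * S $$ (j, l))"
    unfolding g_def by (simp add: pos sum_distrib_left)
  also have "real b / real N * \<dots> = (\<Sum>l<N. S $$ (i, l) * S $$ (j, l))"
    using b by simp
  also have "\<dots> = (S * transpose_mat S) $$ (i, j)"
    using S ij by (simp add: scalar_prod_def atLeast0LessThan)
  finally show "expectation_mat r r (uniform_sampling T b) H $$ (i, j) = (S * transpose_mat S) $$ (i, j)"
    using ij by (simp add: expectation_mat_def)
qed (use S in \<open>simp_all add: expectation_mat_def\<close>)

section \<open>The residual of the factorization\<close>

lemma permutation_matrix_carrier: "permutation_matrix m P \<Longrightarrow> P \<in> carrier_mat m m"
  by (auto simp: permutation_matrix_def)

lemma permutation_matrix_isometry:
  assumes P: "permutation_matrix m P" and v: "v \<in> carrier_vec m"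
  shows "vec_norm2 (P *\<^sub>v v) = vec_norm2 v"
proof -
  obtain p where p: "p permutes {0..<m}" and P: "P = mat m m (\<lambda>(i, j). if i = p j then 1 else 0)"
    using P unfolding permutation_matrix_def by blast
  have "(P *\<^sub>v v) $ p i = v $ i" if i: "i < m" for i
  proof -
    have pi: "p i < m" using p i permutes_in_image[OF p, of i] by simp
    have "(P *\<^sub>v v) $ p i = (\<Sum>j<m. (if p i = p j then 1 else 0) * v $ j)"
      using pi v by (simp add: P scalar_prod_def atLeast0LessThan)
    also have "\<dots> = (\<Sum>j<m. if j = i then v $ j else 0)"
      using permutes_inj[OF p] by (intro sum.cong) (auto dest: injD)
    finally show ?thesis using i by simp
  qed
  moreover have "(\<Sum>i\<in>{0..<m}. ((P *\<^sub>v v) $ i)\<^sup>2) = (\<Sum>i\<in>{0..<m}. ((P *\<^sub>v v) $ p i)\<^sup>2)"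
    using sum.permute[OF p, of "\<lambda>i. ((P *\<^sub>v v) $ i)\<^sup>2"] by simp
  ultimately show ?thesis
    using v by (simp add: vec_norm2_def scalar_prod_self_eq_sum P lessThan_atLeast0 del: index_mult_mat_vec)
qed

text \<open>With \<open>w = A\<^sub>I x\<close> and \<open>z\<close> the part of \<open>x\<close> outside \<open>J\<close>, the factorization gives
  \<open>A x = P (w, E w + S z)\<close>, whereas \<open>U A\<^sub>I x = P (w, E w)\<close>. So the residual maps \<open>x\<close> to
  \<open>P (0, S z)\<close>, of norm \<open>|S z|\<close>, and \<open>|z| \<le> |x|\<close>.\<close>

lemma residual_spectral_norm_le:
  assumes A: "A \<in> carrier_mat m n" and I: "I \<subseteq> {0..<m}" "card I = k"
    and J: "J \<subseteq> {0..<n}" "card J = k"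
    and P: "permutation_matrix m P"
    and E: "E \<in> carrier_mat (m - k) k" and S: "S \<in> carrier_mat (m - k) (n - k)"
    and factorization: "columns_first J A =
        P * four_block_mat (1\<^sub>m k) (0\<^sub>m k (m - k)) E (1\<^sub>m (m - k))
          * four_block_mat (submatrix A I J) (submatrix A I ({0..<n} - J)) (0\<^sub>m (m - k) k) S"
  shows "spectral_norm (A - P * (1\<^sub>m k @\<^sub>r E) * submatrix A I UNIV) \<le> spectral_norm S"
proof (rule spectral_norm_leI)
  let ?A1 = "submatrix A I J" and ?A2 = "submatrix A I ({0..<n} - J)" and ?AI = "submatrix A I UNIV"
  let ?F = "four_block_mat (1\<^sub>m k) (0\<^sub>m k (m - k)) E (1\<^sub>m (m - k))"
  let ?R = "four_block_mat ?A1 ?A2 (0\<^sub>m (m - k) k) S"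
  let ?U1 = "1\<^sub>m k @\<^sub>r E"
  have km: "k \<le> m" "k \<le> n" using card_mono[OF _ I(1)] card_mono[OF _ J(1)] I J by simp_all
  have sub: "{0..<n} - J \<subseteq> {0..<n}" by blast
  have cJ: "card ({0..<n} - J) = n - k" using J card_Diff_subset[of J "{0..<n}"] finite_subset by fastforce
  have Pc: "P \<in> carrier_mat m m" using permutation_matrix_carrier[OF P] .
  have A1: "?A1 \<in> carrier_mat k k" using submatrix_carrier[OF A I(1) J(1)] I J by simp
  have A2: "?A2 \<in> carrier_mat k (n - k)" using submatrix_carrier[OF A I(1) sub] I cJ by simp
  have AI: "?AI \<in> carrier_mat k n"
    using submatrix_carrier[OF A I(1) subset_refl] I by (simp add: submatrix_UNIV_cols[OF A])
  have "?F \<in> carrier_mat (k + (m - k)) (k + (m - k))"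
    by (rule four_block_carrier_mat) simp_all
  then have F: "?F \<in> carrier_mat m m" using km by simp
  have R: "?R \<in> carrier_mat m n" using four_block_carrier_mat[OF A1 S] km by simp
  have U1: "?U1 \<in> carrier_mat m k" using carrier_append_rows[OF one_carrier_mat E] km by simp
  fix x :: "real vec" assume "x \<in> carrier_vec (dim_col (A - P * ?U1 * ?AI))"
  then have x: "x \<in> carrier_vec n" using AI by simp
  let ?y = "subvec x J" and ?z = "subvec x ({0..<n} - J)"
  define w where "w = ?AI *\<^sub>v x"
  define s where "s = S *\<^sub>v ?z"
  have y: "?y \<in> carrier_vec k" and z: "?z \<in> carrier_vec (n - k)"
    using subvec_carrier[of x J] subvec_carrier[of x "{0..<n} - J"] J cJ by simp_all
  have w: "w \<in> carrier_vec k" and s: "s \<in> carrier_vec (m - k)" using AI x S z by (auto simp: w_def s_def)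
  have Ew: "E *\<^sub>v w \<in> carrier_vec (m - k)" using E w by simp
  have yz: "?y @\<^sub>v ?z \<in> carrier_vec n" using append_carrier_vec[OF y z] km by simp
  have "0\<^sub>m (m - k) k *\<^sub>v ?y = 0\<^sub>v (m - k)" using y by (intro eq_vecI) auto
  then have Rx: "?R *\<^sub>v (?y @\<^sub>v ?z) = w @\<^sub>v s"
    using four_block_mat_mult_vec[OF A1 A2 zero_carrier_mat S y z] submatrix_split_cols[OF A I(1) J(1) x] y S z
    by (simp add: w_def s_def)
  have ws: "w @\<^sub>v s \<in> carrier_vec m" using append_carrier_vec[OF w s] km by simp
  have "0\<^sub>m k (m - k) *\<^sub>v s = 0\<^sub>v k" using s by (intro eq_vecI) auto
  then have Fx: "?F *\<^sub>v (w @\<^sub>v s) = w @\<^sub>v (E *\<^sub>v w + s)"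
    using four_block_mat_mult_vec[OF one_carrier_mat zero_carrier_mat E one_carrier_mat w s] w s by simp
  have Ax: "A *\<^sub>v x = P *\<^sub>v (w @\<^sub>v (E *\<^sub>v w + s))"
  proof -
    have "A *\<^sub>v x = (P * ?F * ?R) *\<^sub>v (?y @\<^sub>v ?z)"
      using columns_first_mult_vec[OF A J(1) x] by (simp only: factorization)
    also have "\<dots> = (P * ?F) *\<^sub>v (?R *\<^sub>v (?y @\<^sub>v ?z))"
      by (rule assoc_mult_mat_vec[OF mult_carrier_mat[OF Pc F] R yz])
    also have "\<dots> = P *\<^sub>v (?F *\<^sub>v (w @\<^sub>v s))"
      unfolding Rx by (rule assoc_mult_mat_vec[OF Pc F ws])
    finally show ?thesis unfolding Fx .
  qed
  have Ux: "(P * ?U1 * ?AI) *\<^sub>v x = P *\<^sub>v (w @\<^sub>v (E *\<^sub>v w))"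
  proof -
    have "(P * ?U1 * ?AI) *\<^sub>v x = P *\<^sub>v (?U1 *\<^sub>v w)"
      using assoc_mult_mat_vec[OF mult_carrier_mat[OF Pc U1] AI x] assoc_mult_mat_vec[OF Pc U1 w]
      by (simp add: w_def)
    then show ?thesis using mat_mult_append[OF one_carrier_mat E w] w by simp
  qed
  have app: "w @\<^sub>v (E *\<^sub>v w + s) \<in> carrier_vec m" "w @\<^sub>v (E *\<^sub>v w) \<in> carrier_vec m"
    using append_carrier_vec[OF w add_carrier_vec[OF Ew s]] append_carrier_vec[OF w Ew] km by simp_all
  have "(A - P * ?U1 * ?AI) *\<^sub>v x = P *\<^sub>v (w @\<^sub>v (E *\<^sub>v w + s)) - P *\<^sub>v (w @\<^sub>v (E *\<^sub>v w))"
    using minus_mult_distrib_mat_vec[OF A mult_carrier_mat[OF mult_carrier_mat[OF Pc U1] AI] x]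
    by (simp only: Ax Ux)
  also have "\<dots> = P *\<^sub>v ((w @\<^sub>v (E *\<^sub>v w + s)) - (w @\<^sub>v (E *\<^sub>v w)))"
    by (rule mult_minus_distrib_mat_vec[OF Pc app, symmetric])
  also have "(w @\<^sub>v (E *\<^sub>v w + s)) - (w @\<^sub>v (E *\<^sub>v w)) = 0\<^sub>v k @\<^sub>v s"
    using w s Ew E by (intro eq_vecI) (auto simp del: index_mult_mat_vec)
  finally have "vec_norm2 ((A - P * ?U1 * ?AI) *\<^sub>v x) = vec_norm2 (0\<^sub>v k @\<^sub>v s)"
    using permutation_matrix_isometry[OF P, of "0\<^sub>v k @\<^sub>v s"] append_carrier_vec[OF zero_carrier_vec s, of k] km
    by simp
  also have "\<dots> = vec_norm2 s"
    using scalar_prod_append[OF zero_carrier_vec s zero_carrier_vec s, of k] by (simp add: vec_norm2_def)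
  also have "\<dots> \<le> spectral_norm S * vec_norm2 ?z"
    unfolding s_def by (rule mult_mat_vec_le_spectral_norm) (use S z in simp)
  also have "\<dots> \<le> spectral_norm S * vec_norm2 x"
    by (intro mult_left_mono vec_norm2_subvec_le[OF sub x]) simp
  finally show "vec_norm2 ((A - P * ?U1 * ?AI) *\<^sub>v x) \<le> spectral_norm S * vec_norm2 x" .
qed simp

theorem lemma3p6:
  fixes m n k b :: nat
    and A P A11 A12 A21 A22 A11_inv E S U \<E> :: "real mat"
    and I J :: "nat set"
    and L :: "nat set \<Rightarrow> nat set"
    and H :: "nat set \<Rightarrow> real mat"
    and c f :: real
  assumes A: "A \<in> carrier_mat m n"
    and I: "I \<subseteq> {0..<m}" "card I = k"
    and J: "J \<subseteq> {0..<n}" "card J = k"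
    and k: "1 \<le> k"
    and A11: "A11 = submatrix A I J"
    and A11_inv: "A11_inv \<in> carrier_mat k k" "inverts_mat A11 A11_inv" "inverts_mat A11_inv A11"
    and P: "permutation_matrix m P"
    and A12: "A12 = submatrix A I ({0..<n} - J)"
    and A21: "A21 \<in> carrier_mat (m - k) k"
    and A22: "A22 \<in> carrier_mat (m - k) (n - k)"
    and blocks: "transpose_mat P * columns_first J A = four_block_mat A11 A12 A21 A22"
    and E: "E = A21 * A11_inv"
    and S: "S = A22 - E * A12"
    and factorization:
      "columns_first J A =
        P * four_block_mat (1\<^sub>m k) (0\<^sub>m k (m - k)) E (1\<^sub>m (m - k))
          * four_block_mat A11 A12 (0\<^sub>m (m - k) k) S"
    and b: "1 \<le> b" "b \<le> n - k"
    and L: "\<And>Jh. Jh \<in> samples ({0..<n} - J) b \<Longrightarrow>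
      L Jh \<subseteq> {0..<n - k} \<and> entries_at ({0..<n} - J) (L Jh) = Jh"
    and U: "U = P * (1\<^sub>m k @\<^sub>r E)"
    and residual: "\<E> = A - U * submatrix A I UNIV"
    and c: "1 \<le> c"
    and f: "1 \<le> f"
    and E_bound: "max_norm E \<le> c"
    and sv_A11: "\<And>i. 1 \<le> i \<Longrightarrow> i \<le> k \<Longrightarrow> singular_value i A11 \<ge> singular_value i A / f"
    and sv_S: "\<And>j. 1 \<le> j \<Longrightarrow> j \<le> min m n - k \<Longrightarrow> singular_value j S \<le> singular_value (k + j) A * f"
    and A12_bound: "max_norm (A11_inv * A12) \<le> c"
    and H: "\<And>Jh. H Jh = (real (n - k) / real b) \<cdot>\<^sub>m
      (submatrix S UNIV (L Jh) * transpose_mat (submatrix S UNIV (L Jh)))"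
  shows "spectral_norm \<E> / spectral_norm A
      \<le> sqrt (spectral_norm
          (expectation_mat (m - k) (m - k) (uniform_sampling ({0..<n} - J) b) H)) / spectral_norm A11
    \<and> sqrt (spectral_norm
          (expectation_mat (m - k) (m - k) (uniform_sampling ({0..<n} - J) b) H)) / spectral_norm A11
      \<le> f\<^sup>2 * (singular_value (k + 1) A / spectral_norm A)"
proof -
  let ?T = "{0..<n} - J"
  have km: "k \<le> m" "k \<le> n" using card_mono[OF _ I(1)] card_mono[OF _ J(1)] I J by simp_all
  have cT: "card ?T = n - k" using J card_Diff_subset[of J "{0..<n}"] finite_subset by fastforce
  have A11c: "A11 \<in> carrier_mat k k" using submatrix_carrier[OF A I(1) J(1)] I J by (simp add: A11)
  have A12c: "A12 \<in> carrier_mat k (n - k)"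
    using submatrix_carrier[OF A I(1), of ?T] I cT by (simp add: A12)
  have Ec: "E \<in> carrier_mat (m - k) k" using A21 A11_inv(1) by (simp add: E)
  have Sc: "S \<in> carrier_mat (m - k) (n - k)" 
    unfolding S by (rule minus_carrier_mat[OF mult_carrier_mat[OF Ec A12c]])

  have EH: "expectation_mat (m - k) (m - k) (uniform_sampling ?T b) H = S * transpose_mat S"
    by (rule expectation_sampled_gram[OF Sc _ cT b L H]) auto
  have root: "sqrt (spectral_norm (expectation_mat (m - k) (m - k) (uniform_sampling ?T b) H))
      = spectral_norm S"
    by (simp add: EH spectral_norm_gram)

  have res: "spectral_norm \<E> \<le> spectral_norm S"
    using residual_spectral_norm_le[OF A I J P Ec Sc] factorization
    by (simp add: residual U A11 A12)
  have A11_pos: "0 < spectral_norm A11"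
    using spectral_norm_pos_of_left_inverse[OF A11c A11_inv(1) _ k] A11_inv(1,3)
    by (simp add: inverts_mat_def)
  have A11_le: "spectral_norm A11 \<le> spectral_norm A"
    unfolding A11 by (rule spectral_norm_submatrix_le[OF A I(1) J(1)])
  have A_le: "spectral_norm A \<le> f * spectral_norm A11"
    using sv_A11[of 1] singular_value_1[of A] singular_value_1[of A11] A A11c k km f
    by (simp add: pos_divide_le_eq mult.commute)
  have S_le: "spectral_norm S \<le> f * singular_value (k + 1) A"
  proof (cases "k < m")
    case True
    then show ?thesis
      using sv_S[of 1] singular_value_1[of S] Sc b by (simp add: mult.commute)
  next
    \<comment> \<open>Here \<open>S\<close> has no rows, and there is no bound on its singular values to appeal to.\<close>
    case False
    then have "vec_norm2 (S *\<^sub>v x) \<le> 0 * vec_norm2 x" for x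
      using Sc by (simp add: vec_norm2_def scalar_prod_self_eq_sum)
    then have "spectral_norm S \<le> 0" by (intro spectral_norm_leI) auto
    also have "0 \<le> f * singular_value (k + 1) A" using f singular_value_nonneg by simp
    finally show ?thesis .
  qed

  have "spectral_norm \<E> / spectral_norm A \<le> spectral_norm S / spectral_norm A11"
    by (rule frac_le) (use res A11_pos A11_le in auto)
  moreover have "spectral_norm S / spectral_norm A11 \<le> f\<^sup>2 * (singular_value (k + 1) A / spectral_norm A)"
  proof -
    have "spectral_norm S * spectral_norm A
        \<le> (f * singular_value (k + 1) A) * (f * spectral_norm A11)"
      by (rule mult_mono[OF S_le A_le]) (use f singular_value_nonneg in auto)
    then show ?thesis using A11_pos A11_le by (simp add: field_simps power2_eq_square)
  qed
  ultimately show ?thesis unfolding root by blast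
qed

end
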